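(* Let $n\ge 1$ be an integer. If $f:X\to Y$ is a bornologous function of metric spaces that is coarsely $n$-to-1 and coarsely surjective, then $$\mathrm{asdim}\, X \leq \mathrm{asdim}\, Y\leq (\mathrm{asdim}\, X +1)\cdot n-1.$$
   Context: A function $f:X\to Y$ of metric spaces is bornologous if there is a function $E:[0,\infty)\to[0,\infty)$ such that the image of every subset of $X$ of diameter at most $r$ has diameter at most $E(r)$. A bornologous function $f:X\to Y$ is coarsely $n$-to-1 (with control $C$) if there is a function $C:[0,\infty)\to[0,\infty)$ such that for each subset $B$ of $Y$ with $\mathrm{diam}(B)\le r$ one has $f^{-1}(B)=\bigcup_{i=1}^n A_i$ for some subsets $A_i$ of $X$ with $\mathrm{diam}(A_i)<C(r)$ for $i=1,\dots,n$. For $A\subset Y$ and $R>0$, $B(A,R)$ consists of $A$ and all points at distance less than $R$ from some point of $A$. $f:X\to Y$ is coarsely surjective if $Y\subset B(f(X),R)$ for some $R>0$. The dimension of a family of subsets is the combinatorial dimension of its nerve, i.e. the supremum of all $k$ such that some $k+1$ members have a common point. A metric space $X$ has $\mathrm{asdim}\,X\le m$ ($m\ge 0$ an integer) if every uniformly bounded cover of $X$ can be coarsened to a uniformly bounded family of dimension at most $m$ (i.e. there is such a family such that each element of the cover is contained in some element of it); $\mathrm{asdim}\,X$ is the least such $m\ge 0$, or $\infty$ if there is none. A family is uniformly bounded if the diameters of its members have a common finite upper bound. *)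

theory Defs
  imports "HOL-Analysis.Analysis" "HOL-Library.Extended_Nat"
begin

text \<open>Metric spaces are (possibly empty) subsets \<open>X\<close>, \<open>Y\<close> of types of class \<open>metric_space\<close>,
  with the restricted metric. Since \<^const>\<open>diameter\<close> is total and says nothing about unbounded
  sets, ``\<open>A\<close> has diameter at most \<open>r\<close>'' is always written
  \<open>bounded A \<and> diameter A \<le> r\<close>. The diameter of the empty set is 0.\<close>

text \<open>In both definitions below a function \<open>[0,\<infinity>) \<rightarrow> [0,\<infinity>)\<close> is
  rendered as a function on the reals that is constrained on \<open>r \<ge> 0\<close> only.\<close>

definition bornologous ::
    "'a::metric_space set \<Rightarrow> 'b::metric_space set \<Rightarrow> ('a \<Rightarrow> 'b) \<Rightarrow> bool" where
  "bornologous X Y f \<longleftrightarrow> f \<in> X \<rightarrow> Y \<and>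
     (\<exists>E::real \<Rightarrow> real. \<forall>r\<ge>0. E r \<ge> 0 \<and>
        (\<forall>A\<subseteq>X. bounded A \<and> diameter A \<le> r \<longrightarrow>
           bounded (f ` A) \<and> diameter (f ` A) \<le> E r))"

definition coarsely_n_to_1 ::
    "nat \<Rightarrow> 'a::metric_space set \<Rightarrow> 'b::metric_space set \<Rightarrow> ('a \<Rightarrow> 'b) \<Rightarrow> bool" where
  "coarsely_n_to_1 n X Y f \<longleftrightarrow>
     (\<exists>C::real \<Rightarrow> real. \<forall>r\<ge>0. C r \<ge> 0 \<and>
        (\<forall>B\<subseteq>Y. bounded B \<and> diameter B \<le> r \<longrightarrow>
           (\<exists>A::nat \<Rightarrow> 'a set.
              (\<forall>i\<in>{1..n}. A i \<subseteq> X \<and> bounded (A i) \<and> diameter (A i) < C r) \<and>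
              f -` B \<inter> X = (\<Union>i\<in>{1..n}. A i))))"

definition metric_nbhd :: "'b::metric_space set \<Rightarrow> 'b set \<Rightarrow> real \<Rightarrow> 'b set" where
  "metric_nbhd Y A R = A \<union> {y \<in> Y. \<exists>a\<in>A. dist y a < R}"

definition coarsely_surjective ::
    "'a::metric_space set \<Rightarrow> 'b::metric_space set \<Rightarrow> ('a \<Rightarrow> 'b) \<Rightarrow> bool" where
  "coarsely_surjective X Y f \<longleftrightarrow> (\<exists>R>0. Y \<subseteq> metric_nbhd Y (f ` X) R)"

definition uniformly_bounded :: "'a::metric_space set set \<Rightarrow> bool" where
  "uniformly_bounded \<U> \<longleftrightarrow> (\<exists>D::real. \<forall>A\<in>\<U>. bounded A \<and> diameter A \<le> D)"

text \<open>The supremum of the empty set is 0 here, so a family whose nerve is empty gets dimension 0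
  instead of -1; this is harmless because only bounds by \<open>m \<ge> 0\<close> are used.\<close>

definition family_dim :: "'a set set \<Rightarrow> enat" where
  "family_dim \<U> =
     Sup {enat k | k. \<exists>\<F>\<subseteq>\<U>. finite \<F> \<and> card \<F> = k + 1 \<and> \<Inter>\<F> \<noteq> {}}"

definition coarsens :: "'a set set \<Rightarrow> 'a set set \<Rightarrow> bool" where
  "coarsens \<V> \<U> \<longleftrightarrow> (\<forall>A\<in>\<U>. \<exists>B\<in>\<V>. A \<subseteq> B)"

definition asdim_at_most :: "'a::metric_space set \<Rightarrow> nat \<Rightarrow> bool" where
  "asdim_at_most X m \<longleftrightarrow>
     (\<forall>\<U>. \<U> \<subseteq> Pow X \<and> \<Union>\<U> = X \<and> uniformly_bounded \<U> \<longrightarrow>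
        (\<exists>\<V>. \<V> \<subseteq> Pow X \<and> uniformly_bounded \<V> \<and> family_dim \<V> \<le> enat m \<and>
              coarsens \<V> \<U>))"

text \<open>The infimum of the empty set in \<^typ>\<open>enat\<close> is \<open>\<infinity>\<close>.\<close>

definition asdim :: "'a::metric_space set \<Rightarrow> enat" where
  "asdim X = Inf {enat m | m. asdim_at_most X m}"

end

theory Submission
  imports Defs
begin

text \<open>For \<open>asdim X \<le> asdim Y\<close>, pull a family of dimension \<open>m\<close> on \<open>Y\<close> back along \<open>f\<close> and split every
  preimage into its \<open>D\<close>-chain components. A preimage is a union of \<open>n\<close> sets of controlled diameter, so
  its components are uniformly bounded, and a point lies in one component of each preimage, so
  the dimension does not grow.

  For the upper bound on \<open>asdim Y\<close>, take a family \<open>\<W>\<close> of dimension \<open>m\<close> on \<open>X\<close> with large Lebesgue number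
  and shrink its members so that a set of diameter at most \<open>r\<close> meets at most \<open>m + 1\<close> of them. Enlarged images
  of the shrunken members coarsen the given cover of \<open>Y\<close>; a point \<open>y\<close> lies in such an image only if
  the member meets the preimage of a ball about \<open>y\<close>, which consists of \<open>n\<close> sets of diameter at most \<open>r\<close>.\<close>

section \<open>Diameter, dimension of families, and asymptotic dimension\<close>

text \<open>This replaces \<open>diameter\<close> by pointwise distances, the form used in all later
  estimates. Nonnegativity of \<open>D\<close> covers the empty set, whose diameter is 0.\<close>

lemma bounded_diameter_le_iff:
  fixes A :: "'a::metric_space set"
  assumes "D \<ge> 0"
  shows "bounded A \<and> diameter A \<le> D \<longleftrightarrow> (\<forall>x\<in>A. \<forall>y\<in>A. dist x y \<le> D)"
proof (intro iffI conjI)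
  assume "bounded A \<and> diameter A \<le> D"
  then show "\<forall>x\<in>A. \<forall>y\<in>A. dist x y \<le> D"
    using diameter_bounded_bound order_trans by blast
next
  assume close: "\<forall>x\<in>A. \<forall>y\<in>A. dist x y \<le> D"
  then show "bounded A"
    unfolding bounded_def by blast
  have "(SUP (x, y)\<in>A \<times> A. dist x y) \<le> D" if "A \<noteq> {}"
    using close that by (intro cSUP_least) auto
  then show "diameter A \<le> D"
    using assms by (simp add: diameter_def)
qed

lemma uniformly_bounded_iff:
  "uniformly_bounded \<U> \<longleftrightarrow> (\<exists>D\<ge>0. \<forall>A\<in>\<U>. \<forall>x\<in>A. \<forall>y\<in>A. dist x y \<le> D)"
proof
  assume "uniformly_bounded \<U>"
  then obtain D where "\<forall>A\<in>\<U>. bounded A \<and> diameter A \<le> D"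
    unfolding uniformly_bounded_def by blast
  \<comment> \<open>The bound can be negative only when the family is empty; \<open>max D 0\<close>
    repairs this.\<close>
  then have "\<forall>A\<in>\<U>. bounded A \<and> diameter A \<le> max D 0"
    by fastforce
  then show "\<exists>D\<ge>0. \<forall>A\<in>\<U>. \<forall>x\<in>A. \<forall>y\<in>A. dist x y \<le> D"
    by (metis bounded_diameter_le_iff max.cobounded2)
next
  assume "\<exists>D\<ge>0. \<forall>A\<in>\<U>. \<forall>x\<in>A. \<forall>y\<in>A. dist x y \<le> D"
  then show "uniformly_bounded \<U>"
    unfolding uniformly_bounded_def by (metis bounded_diameter_le_iff)
qed

lemma family_dim_le_iff:
  "family_dim \<U> \<le> enat m \<longleftrightarrow>
     (\<forall>\<F>\<subseteq>\<U>. finite \<F> \<and> \<Inter>\<F> \<noteq> {} \<longrightarrow> card \<F> \<le> m + 1)"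
proof
  assume dim: "family_dim \<U> \<le> enat m"
  show "\<forall>\<F>\<subseteq>\<U>. finite \<F> \<and> \<Inter>\<F> \<noteq> {} \<longrightarrow> card \<F> \<le> m + 1"
  proof (intro allI impI)
    fix \<F> assume "\<F> \<subseteq> \<U>" and \<F>: "finite \<F> \<and> \<Inter>\<F> \<noteq> {}"
    show "card \<F> \<le> m + 1"
    \<comment> \<open>A subfamily with \<open>Suc k\<close> members contributes \<open>k\<close> to
      the supremum; the empty one contributes nothing.\<close>
    proof (cases "card \<F>")
      case (Suc k)
      then have "enat k \<le> family_dim \<U>"
        unfolding family_dim_def using \<open>\<F> \<subseteq> \<U>\<close> \<F> by (intro Sup_upper) auto
      with dim have "enat k \<le> enat m"
        by (rule order_trans[rotated])
      with Suc show ?thesis by simp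
    qed simp
  qed
next
  assume "\<forall>\<F>\<subseteq>\<U>. finite \<F> \<and> \<Inter>\<F> \<noteq> {} \<longrightarrow> card \<F> \<le> m + 1"
  then show "family_dim \<U> \<le> enat m"
    unfolding family_dim_def by (fastforce intro!: Sup_least)
qed

lemma asdim_le: "asdim_at_most X m \<Longrightarrow> asdim X \<le> enat m"
  unfolding asdim_def by (rule Inf_lower) blast

text \<open>The infimum is attained: a finite value rules out the empty set, whose infimum is
  infinite, and a nonempty set of \<open>enat\<close> has a least element.\<close>

lemma asdim_at_most_asdim:
  assumes "asdim X = enat m"
  shows "asdim_at_most X m"
proof -
  let ?S = "{enat k | k. asdim_at_most X k}"
  have "?S \<noteq> {}"
    using assms unfolding asdim_def Inf_enat_def by (auto split: if_splits)
  then have "Inf ?S \<in> ?S"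
    unfolding Inf_enat_def by (metis (no_types, lifting) LeastI ex_in_conv)
  then show ?thesis
    using assms unfolding asdim_def by auto
qed

text \<open>Pieces may be empty or overlap, so \<open>n\<close> is only an upper bound on their
  number. The bound \<open>c\<close> is not strict, so that it also suits single points when
  \<open>c\<close> is 0.\<close>

definition small_pieces :: "nat \<Rightarrow> real \<Rightarrow> 'a::metric_space set \<Rightarrow> bool" where
  "small_pieces n c S \<longleftrightarrow>
     (\<exists>A. (\<forall>i\<in>{1..n}. \<forall>x\<in>A i. \<forall>y\<in>A i. dist x y \<le> c) \<and> S = (\<Union>i\<in>{1..n}. A i))"

lemma coarsely_n_to_1_dist:
  assumes "coarsely_n_to_1 n X Y f" "r \<ge> 0"
  shows "\<exists>c\<ge>0. \<forall>B\<subseteq>Y. (\<forall>u\<in>B. \<forall>v\<in>B. dist u v \<le> r) \<longrightarrow> small_pieces n c (f -` B \<inter> X)"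
proof -
  obtain c where c: "c \<ge> 0"
    and ex: "\<forall>B\<subseteq>Y. bounded B \<and> diameter B \<le> r \<longrightarrow>
      (\<exists>A. (\<forall>i\<in>{1..n}. A i \<subseteq> X \<and> bounded (A i) \<and> diameter (A i) < c) \<and>
           f -` B \<inter> X = (\<Union>i\<in>{1..n}. A i))"
    using assms unfolding coarsely_n_to_1_def by metis
  show ?thesis
  proof (intro exI[of _ c] conjI allI impI)
    fix B assume "B \<subseteq> Y" "\<forall>u\<in>B. \<forall>v\<in>B. dist u v \<le> r"
    then obtain A where A: "\<forall>i\<in>{1..n}. bounded (A i) \<and> diameter (A i) < c"
      "f -` B \<inter> X = (\<Union>i\<in>{1..n}. A i)"
      using ex bounded_diameter_le_iff[OF assms(2)] by metis
    then have "\<forall>i\<in>{1..n}. \<forall>x\<in>A i. \<forall>y\<in>A i. dist x y \<le> c"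
      using bounded_diameter_le_iff[OF c] by (meson less_imp_le)
    with A(2) show "small_pieces n c (f -` B \<inter> X)"
      unfolding small_pieces_def by blast
  qed (fact c)
qed

lemma bornologous_dist:
  assumes "bornologous X Y f" "r \<ge> 0"
  shows "\<exists>e\<ge>0. \<forall>A\<subseteq>X. (\<forall>u\<in>A. \<forall>v\<in>A. dist u v \<le> r) \<longrightarrow> (\<forall>x\<in>A. \<forall>y\<in>A. dist (f x) (f y) \<le> e)"
proof -
  obtain e where e: "e \<ge> 0"
    and ex: "\<forall>A\<subseteq>X. bounded A \<and> diameter A \<le> r \<longrightarrow> bounded (f ` A) \<and> diameter (f ` A) \<le> e"
    using assms unfolding bornologous_def by metis
  show ?thesis
  proof (intro exI[of _ e] conjI allI impI)
    fix A assume "A \<subseteq> X" "\<forall>u\<in>A. \<forall>v\<in>A. dist u v \<le> r"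
    then have "bounded (f ` A) \<and> diameter (f ` A) \<le> e"
      using ex bounded_diameter_le_iff[OF assms(2)] by blast
    then show "\<forall>x\<in>A. \<forall>y\<in>A. dist (f x) (f y) \<le> e"
      using bounded_diameter_le_iff[OF e, of "f ` A"] by simp
  qed (fact e)
qed

section \<open>Chain components\<close>

text \<open>Both ends must lie in \<open>S\<close>, so chains never leave \<open>S\<close>; removing
  a piece from \<open>S\<close> therefore really restricts the chains.\<close>

definition chain_step :: "real \<Rightarrow> 'a::metric_space set \<Rightarrow> ('a \<times> 'a) set" where
  "chain_step D S = {(x, y). x \<in> S \<and> y \<in> S \<and> dist x y \<le> D}"

definition chain_comp :: "real \<Rightarrow> 'a::metric_space set \<Rightarrow> 'a \<Rightarrow> 'a set" where
  "chain_comp D S x = (chain_step D S)\<^sup>* `` {x}"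

lemma sym_chain_step_rtrancl: "sym ((chain_step D S)\<^sup>*)"
  by (rule sym_rtrancl) (auto simp: chain_step_def dist_commute intro!: symI)

lemma chain_comp_subset: "x \<in> S \<Longrightarrow> chain_comp D S x \<subseteq> S"
  unfolding chain_comp_def by (auto elim: rtranclE simp: chain_step_def)

text \<open>Chains can be reversed and concatenated, so components are equivalence classes and any
  member can serve as base point.\<close>

lemma chain_comp_eq:
  assumes "y \<in> chain_comp D S x"
  shows "chain_comp D S x = chain_comp D S y"
  using assms symD[OF sym_chain_step_rtrancl[of D S], of x y]
  unfolding chain_comp_def by (auto intro: rtrancl_trans)

text \<open>Cut the chain at its last visit to \<open>A\<close>: \<open>z\<close> is that visit,
  \<open>z'\<close> the next point, and the rest avoids \<open>A\<close>. This allows an induction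
  that discards one piece at a time.\<close>

lemma chain_last_exit:
  assumes "(x, y) \<in> (chain_step D S)\<^sup>*" "x \<in> A" "y \<notin> A"
  obtains z z' where "z \<in> A" "z' \<in> S - A" "dist z z' \<le> D" "(z', y) \<in> (chain_step D (S - A))\<^sup>*"
proof -
  have "y \<in> A \<or> (\<exists>z\<in>A. \<exists>z'\<in>S - A. dist z z' \<le> D \<and> (z', y) \<in> (chain_step D (S - A))\<^sup>*)"
    using assms(1)
  proof (induction rule: rtrancl_induct)
    case base
    then show ?case using assms(2) by blast
  next
    case (step y w)
    have st: "y \<in> S" "w \<in> S" "dist y w \<le> D"
      using step.hyps(2) by (auto simp: chain_step_def)
    show ?case
    \<comment> \<open>If \<open>y\<close> is in \<open>A\<close> and \<open>w\<close> is not, the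
      step from \<open>y\<close> to \<open>w\<close> is the new last exit, with an empty tail; if
      both are outside, the old tail is extended.\<close>
    proof (cases "w \<in> A \<or> y \<in> A")
      case True
      then show ?thesis using st by blast
    next
      case False
      then have "(y, w) \<in> chain_step D (S - A)"
        using st by (auto simp: chain_step_def)
      with False step.IH show ?thesis
        by (meson rtrancl.rtrancl_into_rtrancl)
    qed
  qed
  with assms(3) that show ?thesis by blast
qed

text \<open>Each piece costs at most \<open>c\<close> to cross up to the last visit and
  \<open>D\<close> to jump out of it, and it is never entered again. Hence the bound depends on the
  number of pieces but not on the length of the chain.\<close>

lemma chain_dist_le:
  assumes "finite I" "c \<ge> 0" "D \<ge> 0"
    and "\<And>i u v. i \<in> I \<Longrightarrow> u \<in> A i \<Longrightarrow> v \<in> A i \<Longrightarrow> dist u v \<le> c"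
    and "S \<subseteq> (\<Union>i\<in>I. A i)" "x \<in> S" "(x, y) \<in> (chain_step D S)\<^sup>*"
  shows "dist x y \<le> real (card I) * (c + D)"
  using assms
proof (induction "card I" arbitrary: I S x)
  case 0
  then show ?case by auto
next
  case (Suc k)
  obtain i where i: "i \<in> I" "x \<in> A i"
    using Suc.prems by blast
  have card: "card I = Suc k" "card (I - {i}) = k"
    using Suc.hyps(2) i(1) Suc.prems(1) by auto
  show ?case
  proof (cases "y \<in> A i")
    case True
    then have "dist x y \<le> 1 * (c + D)"
      using Suc.prems(4)[OF i] Suc.prems(3) by fastforce
    also have "\<dots> \<le> real (card I) * (c + D)"
      using card Suc.prems(2,3) by (intro mult_right_mono) auto
    finally show ?thesis .
  next
    case False
    obtain z z' where z: "z \<in> A i" "z' \<in> S - A i" "dist z z' \<le> D"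
      "(z', y) \<in> (chain_step D (S - A i))\<^sup>*"
      using chain_last_exit[OF Suc.prems(7) i(2) False] by blast
    \<comment> \<open>The tail runs inside \<open>S - A i\<close>, which the remaining
      \<open>k\<close> pieces cover.\<close>
    have "dist z' y \<le> real (card (I - {i})) * (c + D)"
    proof (rule Suc.hyps(1))
      show "S - A i \<subseteq> (\<Union>j\<in>I - {i}. A j)"
        using Suc.prems(5) by blast
    qed (use card Suc.prems z in auto)
    moreover have "dist x z \<le> c"
      using Suc.prems(4)[OF i z(1)] .
    moreover have "dist x y \<le> dist x z + dist z z' + dist z' y"
      by (meson add_right_mono dist_triangle order_trans)
    ultimately show ?thesis
      using z(3) card by (simp add: algebra_simps)
  qed
qed

section \<open>The two inequalities\<close>

lemma asdim_at_most_domain: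
  fixes X :: "'a::metric_space set" and Y :: "'b::metric_space set"
  assumes "bornologous X Y f" "coarsely_n_to_1 n X Y f" "asdim_at_most Y m"
  shows "asdim_at_most X m"
  unfolding asdim_at_most_def
proof (intro allI impI)
  fix \<U> :: "'a set set"
  assume \<U>: "\<U> \<subseteq> Pow X \<and> \<Union>\<U> = X \<and> uniformly_bounded \<U>"
  then have "uniformly_bounded \<U>" by blast
  then obtain D where D: "D \<ge> 0" "\<forall>A\<in>\<U>. \<forall>x\<in>A. \<forall>y\<in>A. dist x y \<le> D"
    unfolding uniformly_bounded_iff by blast
  obtain e where e: "e \<ge> 0"
    "\<forall>A\<subseteq>X. (\<forall>u\<in>A. \<forall>v\<in>A. dist u v \<le> D) \<longrightarrow> (\<forall>x\<in>A. \<forall>y\<in>A. dist (f x) (f y) \<le> e)"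
    using bornologous_dist[OF assms(1) D(1)] by blast
  \<comment> \<open>The images alone need not cover \<open>Y\<close>; singletons complete them to a
    cover without raising the diameter bound.\<close>
  define \<U>' where "\<U>' = (`) f ` \<U> \<union> (\<lambda>y. {y}) ` Y"
  have fXY: "f ` X \<subseteq> Y"
    using assms(1) unfolding bornologous_def by blast
  have "uniformly_bounded \<U>'"
    unfolding uniformly_bounded_iff
  proof (intro exI conjI ballI)
    show "0 \<le> e" by (fact e(1))
    fix A u v assume "A \<in> \<U>'" "u \<in> A" "v \<in> A"
    then consider x y A' where "A' \<in> \<U>" "x \<in> A'" "y \<in> A'" "u = f x" "v = f y" | "u = v"
      unfolding \<U>'_def by blast
    then show "dist u v \<le> e"
    proof cases
      case 1
      then have "A' \<subseteq> X" using \<U> by blast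
      with 1 show ?thesis using e(2) D(2) by blast
    qed (use e(1) in simp)
  qed
  moreover have "\<U>' \<subseteq> Pow Y" "\<Union>\<U>' = Y"
    using \<U> fXY unfolding \<U>'_def by auto
  ultimately obtain \<V> where \<V>: "\<V> \<subseteq> Pow Y" "uniformly_bounded \<V>" "family_dim \<V> \<le> enat m"
    "coarsens \<V> \<U>'"
    using assms(3) unfolding asdim_at_most_def by metis
  obtain r where r: "r \<ge> 0" "\<forall>B\<in>\<V>. \<forall>u\<in>B. \<forall>v\<in>B. dist u v \<le> r"
    using \<V>(2) unfolding uniformly_bounded_iff by blast
  obtain c where c: "c \<ge> 0"
    "\<forall>B\<subseteq>Y. (\<forall>u\<in>B. \<forall>v\<in>B. dist u v \<le> r) \<longrightarrow> small_pieces n c (f -` B \<inter> X)"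
    using coarsely_n_to_1_dist[OF assms(2) r(1)] by blast
  define pre where "pre B = f -` B \<inter> X" for B
  \<comment> \<open>The chain scale \<open>D\<close> bounds the members of the given cover, so none
    of them is split. The empty set is inserted because the cover may contain it while there are no
    components at all.\<close>
  define \<W> where "\<W> = insert {} {chain_comp D (pre B) x | B x. B \<in> \<V> \<and> x \<in> pre B}"
  have "uniformly_bounded \<W>"
    unfolding uniformly_bounded_iff
  proof (intro exI conjI ballI)
    show "0 \<le> real n * (c + D)"
      using c(1) D(1) by simp
    fix W u v assume "W \<in> \<W>" "u \<in> W" "v \<in> W"
    then obtain B x where B: "B \<in> \<V>" "x \<in> pre B" and W: "W = chain_comp D (pre B) x"
      unfolding \<W>_def by blast
    have "B \<subseteq> Y" "\<forall>u\<in>B. \<forall>v\<in>B. dist u v \<le> r"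
      using B(1) \<V>(1) r(2) by auto
    then have "small_pieces n c (pre B)"
      using c(2) by (simp add: pre_def)
    then obtain A where "\<forall>i\<in>{1..n}. \<forall>x\<in>A i. \<forall>y\<in>A i. dist x y \<le> c"
      "pre B = (\<Union>i\<in>{1..n}. A i)"
      unfolding small_pieces_def by blast
    moreover have "u \<in> pre B" "v \<in> chain_comp D (pre B) u"
      using chain_comp_subset[OF B(2)] chain_comp_eq \<open>u \<in> W\<close> \<open>v \<in> W\<close> unfolding W by blast+
    ultimately have "dist u v \<le> real (card {1..n}) * (c + D)"
      using c(1) D(1) by (intro chain_dist_le[where A = A and S = "pre B"]) (auto simp: chain_comp_def)
    then show "dist u v \<le> real n * (c + D)" by simp
  qed
  moreover have "family_dim \<W> \<le> enat m"
    unfolding family_dim_le_iff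
  proof (intro allI impI)
    fix \<F> assume \<F>: "\<F> \<subseteq> \<W>" "finite \<F> \<and> \<Inter>\<F> \<noteq> {}"
    then obtain x where x: "\<forall>W\<in>\<F>. x \<in> W" by auto
    have "\<exists>B\<in>\<V>. f x \<in> B \<and> W = chain_comp D (pre B) x" if "W \<in> \<F>" for W
    proof -
      have "W \<in> \<W>" "x \<in> W"
        using that \<F>(1) x by auto
      then obtain B x0 where B: "B \<in> \<V>" "x0 \<in> pre B" "W = chain_comp D (pre B) x0"
        unfolding \<W>_def by blast
      moreover from this have "W = chain_comp D (pre B) x" "x \<in> pre B"
        using chain_comp_eq chain_comp_subset \<open>x \<in> W\<close> by blast+
      ultimately show ?thesis unfolding pre_def by blast
    qed
    then have "\<F> \<subseteq> (\<lambda>B. chain_comp D (pre B) x) ` {B\<in>\<V>. f x \<in> B}" by blast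
    \<comment> \<open>Choose one member of \<open>\<V>\<close> for each component in
      \<open>\<F>\<close>. All chosen members contain \<open>f x\<close>, so the dimension bound for
      \<open>\<V>\<close> limits their number.\<close>
    then obtain \<G> where \<G>: "\<G> \<subseteq> {B\<in>\<V>. f x \<in> B}" "inj_on (\<lambda>B. chain_comp D (pre B) x) \<G>"
      "\<F> = (\<lambda>B. chain_comp D (pre B) x) ` \<G>"
      unfolding subset_image_inj by blast
    then have "card \<F> = card \<G>" "finite \<G>"
      using \<F>(2) by (auto simp: card_image finite_image_iff)
    moreover have "\<G> \<subseteq> \<V>" "\<Inter>\<G> \<noteq> {}"
      using \<G>(1) by auto
    ultimately show "card \<F> \<le> m + 1"
      using \<V>(3) unfolding family_dim_le_iff by metis
  qed
  moreover have "coarsens \<W> \<U>"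
    unfolding coarsens_def
  proof
    fix A assume A: "A \<in> \<U>"
    show "\<exists>W\<in>\<W>. A \<subseteq> W"
    proof (cases "A = {}")
      case True
      then show ?thesis unfolding \<W>_def by blast
    next
      case False
      then obtain x where x: "x \<in> A" by blast
      have "f ` A \<in> \<U>'"
        using A unfolding \<U>'_def by blast
      then obtain B where B: "B \<in> \<V>" "f ` A \<subseteq> B"
        using \<V>(4) unfolding coarsens_def by blast
      then have sub: "A \<subseteq> pre B"
        using A \<U> unfolding pre_def by blast
      \<comment> \<open>Every point of \<open>A\<close> is a single step away from
        \<open>x\<close>.\<close>
      then have "A \<subseteq> chain_comp D (pre B) x"
        using x A D(2) unfolding chain_comp_def chain_step_def
        by auto
      with sub x B(1) show ?thesis unfolding \<W>_def by blast
    qed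
  qed
  moreover have "\<W> \<subseteq> Pow X"
    by (auto simp: \<W>_def pre_def dest!: subsetD[OF chain_comp_subset, rotated])
  ultimately show "\<exists>\<W>\<subseteq>Pow X. uniformly_bounded \<W> \<and> family_dim \<W> \<le> enat m \<and> coarsens \<W> \<U>"
    by (intro exI[of _ \<W>] conjI)
qed

text \<open>Coarsening the cover by balls of radius \<open>r\<close>, whose diameters are at most
  \<open>2 * r\<close>, gives a family with Lebesgue number at least \<open>r\<close>.\<close>

lemma asdim_at_most_lebesgue_number:
  fixes X :: "'a::metric_space set"
  assumes "asdim_at_most X m" "r \<ge> 0"
  shows "\<exists>\<W>\<subseteq>Pow X. uniformly_bounded \<W> \<and> family_dim \<W> \<le> enat m \<and>
    (\<forall>x\<in>X. \<exists>W\<in>\<W>. cball x r \<inter> X \<subseteq> W)"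
proof -
  define \<U> where "\<U> = (\<lambda>x. cball x r \<inter> X) ` X"
  have "dist u v \<le> 2 * r" if "u \<in> cball x r" "v \<in> cball x r" for x u v :: 'a
    using that dist_triangle3[of u v x] by simp
  then have "uniformly_bounded \<U>"
    unfolding uniformly_bounded_iff \<U>_def
    using assms(2) by (intro exI[of _ "2 * r"]) auto
  moreover have "\<U> \<subseteq> Pow X" "\<Union>\<U> = X"
    using assms(2) unfolding \<U>_def by auto
  ultimately obtain \<W> where "\<W> \<subseteq> Pow X" "uniformly_bounded \<W>" "family_dim \<W> \<le> enat m"
    "coarsens \<W> \<U>"
    using assms(1) unfolding asdim_at_most_def by metis
  moreover from this have "\<forall>x\<in>X. \<exists>W\<in>\<W>. cball x r \<inter> X \<subseteq> W"
    unfolding coarsens_def \<U>_def by simp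
  ultimately show ?thesis
    by (intro exI[of _ \<W>] conjI)
qed

lemma asdim_at_most_codomain:
  fixes X :: "'a::metric_space set" and Y :: "'b::metric_space set"
  assumes "n \<ge> 1" "bornologous X Y f" "coarsely_n_to_1 n X Y f" "coarsely_surjective X Y f"
    and "asdim_at_most X m"
  shows "asdim_at_most Y ((m + 1) * n - 1)"
  unfolding asdim_at_most_def
proof (intro allI impI)
  fix \<U> :: "'b set set"
  assume \<U>: "\<U> \<subseteq> Pow Y \<and> \<Union>\<U> = Y \<and> uniformly_bounded \<U>"
  then have "uniformly_bounded \<U>" by blast
  then obtain D where D: "D \<ge> 0" "\<forall>A\<in>\<U>. \<forall>x\<in>A. \<forall>y\<in>A. dist x y \<le> D"
    unfolding uniformly_bounded_iff by blast
  have fXY: "f ` X \<subseteq> Y"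
    using assms(2) unfolding bornologous_def by blast
  obtain R where R: "R > 0" "Y \<subseteq> metric_nbhd Y (f ` X) R"
    using assms(4) unfolding coarsely_surjective_def by blast
  have near: "\<exists>x\<in>X. dist y (f x) < R" if "y \<in> Y" for y
    using that R unfolding metric_nbhd_def by force
  \<comment> \<open>A member of the cover lies within \<open>D\<close> of each of its points, and
    each such point is within \<open>R\<close> of the image; so \<open>s\<close> is the enlargement
    that swallows the whole member.\<close>
  define s where "s = R + D"
  have s: "s > 0" "2 * s > 0" using R(1) D(1) by (simp_all add: s_def)
  obtain c where c: "c \<ge> 0"
    "\<forall>B\<subseteq>Y. (\<forall>u\<in>B. \<forall>v\<in>B. dist u v \<le> 2 * s) \<longrightarrow> small_pieces n c (f -` B \<inter> X)"
    using coarsely_n_to_1_dist[OF assms(3) less_imp_le[OF s(2)]] by blast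
  \<comment> \<open>The Lebesgue number is the size \<open>c\<close> of the pieces: a piece that
    meets the core of \<open>W\<close> then lies entirely in \<open>W\<close>.\<close>
  obtain \<W> where \<W>: "\<W> \<subseteq> Pow X" "uniformly_bounded \<W>" "family_dim \<W> \<le> enat m"
    "\<forall>x\<in>X. \<exists>W\<in>\<W>. cball x c \<inter> X \<subseteq> W"
    using asdim_at_most_lebesgue_number[OF assms(5) c(1)] by blast
  obtain d where d: "d \<ge> 0" "\<forall>W\<in>\<W>. \<forall>u\<in>W. \<forall>v\<in>W. dist u v \<le> d"
    using \<W>(2) unfolding uniformly_bounded_iff by blast
  obtain e where e: "e \<ge> 0"
    "\<forall>A\<subseteq>X. (\<forall>u\<in>A. \<forall>v\<in>A. dist u v \<le> d) \<longrightarrow> (\<forall>x\<in>A. \<forall>y\<in>A. dist (f x) (f y) \<le> e)"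
    using bornologous_dist[OF assms(2) d(1)] by blast
  define core where "core W = {x \<in> X. cball x c \<inter> X \<subseteq> W}" for W
  have core_sub: "core W \<subseteq> W" for W
    unfolding core_def using c(1) by auto
  define T where "T W = {y \<in> Y. \<exists>x\<in>core W. dist y (f x) < s}" for W
  define \<V> where "\<V> = insert {} (T ` \<W>)"
  have "uniformly_bounded \<V>"
    unfolding uniformly_bounded_iff
  proof (intro exI conjI ballI)
    \<comment> \<open>Two enlargements by \<open>s\<close>, plus \<open>e\<close> for the image of a
      set \<open>W\<close>.\<close>
    show "0 \<le> e + 2 * s" using e(1) s by simp
    fix V u v assume "V \<in> \<V>" "u \<in> V" "v \<in> V"
    then obtain W x y where W: "W \<in> \<W>" "x \<in> W" "y \<in> W" "dist u (f x) < s" "dist v (f y) < s"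
      unfolding \<V>_def T_def using core_sub by blast
    then have "W \<subseteq> X" "\<forall>u\<in>W. \<forall>v\<in>W. dist u v \<le> d"
      using d(2) \<W>(1) by auto
    then have "dist (f x) (f y) \<le> e"
      using e(2) W(2,3) by simp
    moreover have "dist u v \<le> dist u (f x) + dist (f x) (f y) + dist v (f y)"
      using dist_triangle[of u v "f x"] dist_triangle[of "f x" v "f y"] by (simp add: dist_commute)
    ultimately show "dist u v \<le> e + 2 * s"
      using W by linarith
  qed
  moreover have "family_dim \<V> \<le> enat ((m + 1) * n - 1)"
    unfolding family_dim_le_iff
  proof (intro allI impI)
    fix \<F> assume \<F>: "\<F> \<subseteq> \<V>" "finite \<F> \<and> \<Inter>\<F> \<noteq> {}"
    then obtain y where y: "\<forall>V\<in>\<F>. y \<in> V" by auto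
    \<comment> \<open>The inserted empty set cannot occur, since \<open>y\<close> lies in every
      member of \<open>\<F>\<close>.\<close>
    then have "\<F> \<subseteq> T ` \<W>"
      using \<F>(1) unfolding \<V>_def by blast
    then obtain \<G> where \<G>: "\<G> \<subseteq> \<W>" "inj_on T \<G>" "\<F> = T ` \<G>"
      unfolding subset_image_inj by blast
    then have card_eq: "card \<F> = card \<G>" and fin: "finite \<G>"
      using \<F>(2) by (auto simp: card_image finite_image_iff)
    define B where "B = ball y s \<inter> Y"
    have "\<forall>u\<in>B. \<forall>v\<in>B. dist u v \<le> 2 * s"
    proof (intro ballI)
      fix u v assume "u \<in> B" "v \<in> B"
      then show "dist u v \<le> 2 * s"
        using dist_triangle3[of u v y] unfolding B_def by simp
    qed
    moreover have "B \<subseteq> Y"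
      unfolding B_def by blast
    ultimately have "small_pieces n c (f -` B \<inter> X)"
      using c(2) by simp
    then obtain A where A: "\<forall>i\<in>{1..n}. \<forall>x\<in>A i. \<forall>y\<in>A i. dist x y \<le> c"
      "f -` B \<inter> X = (\<Union>i\<in>{1..n}. A i)"
      unfolding small_pieces_def by blast
    \<comment> \<open>Membership of \<open>y\<close> in \<open>T W\<close> puts a point of
      \<open>core W\<close> into the preimage of \<open>B\<close>, hence into some piece. So the
      \<open>n\<close> subfamilies exhaust \<open>\<G>\<close>.\<close>
    define \<G>' where "\<G>' i = {W \<in> \<G>. core W \<inter> A i \<noteq> {}}" for i
    have "\<G> \<subseteq> (\<Union>i\<in>{1..n}. \<G>' i)"
    proof
      fix W assume W: "W \<in> \<G>"
      then have "y \<in> T W" using y \<G>(3) by blast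
      then obtain x where x: "x \<in> core W" "dist y (f x) < s"
        unfolding T_def by blast
      moreover from this have "x \<in> f -` B \<inter> X"
        using fXY unfolding B_def core_def by auto
      ultimately show "W \<in> (\<Union>i\<in>{1..n}. \<G>' i)"
        using W A(2) unfolding \<G>'_def by blast
    qed
    then have "card \<G> \<le> card (\<Union>i\<in>{1..n}. \<G>' i)"
      by (rule card_mono[rotated]) (use fin in \<open>auto simp: \<G>'_def\<close>)
    also have "\<dots> \<le> (\<Sum>i\<in>{1..n}. card (\<G>' i))"
      by (rule card_UN_le) simp
    also have "\<dots> \<le> (\<Sum>i\<in>{1..n}. m + 1)"
    proof (rule sum_mono)
      fix i assume i: "i \<in> {1..n}"
      show "card (\<G>' i) \<le> m + 1"
      proof (cases "A i = {}")
        case True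
        then show ?thesis unfolding \<G>'_def by simp
      next
        case False
        \<comment> \<open>One point of the piece suffices: it lies in every \<open>W\<close> whose
          core meets the piece, so at most \<open>m + 1\<close> such \<open>W\<close> occur.\<close>
        then obtain a where a: "a \<in> A i" by blast
        then have "a \<in> X" using A(2) i by blast
        have "a \<in> W" if W: "W \<in> \<G>' i" for W
        proof -
          obtain x where "x \<in> core W" "x \<in> A i"
            using W unfolding \<G>'_def by blast
          moreover from this have "dist x a \<le> c"
            using A(1) i a by blast
          ultimately show ?thesis
            using \<open>a \<in> X\<close> unfolding core_def by auto
        qed
        then have "\<Inter>(\<G>' i) \<noteq> {}" by blast
        moreover have "\<G>' i \<subseteq> \<W>" "finite (\<G>' i)"
          using \<G>(1) fin unfolding \<G>'_def by auto
        ultimately show ?thesis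
          using \<W>(3) unfolding family_dim_le_iff by metis
      qed
    qed
    \<comment> \<open>Since \<open>n\<close> is positive, the truncated subtraction loses
      nothing.\<close>
    also have "\<dots> = (m + 1) * n - 1 + 1"
      using assms(1) by simp
    finally show "card \<F> \<le> (m + 1) * n - 1 + 1"
      using card_eq by simp
  qed
  moreover have "coarsens \<V> \<U>"
    unfolding coarsens_def
  proof
    fix A assume A: "A \<in> \<U>"
    show "\<exists>V\<in>\<V>. A \<subseteq> V"
    proof (cases "A = {}")
      case True
      then show ?thesis unfolding \<V>_def by blast
    next
      case False
      then obtain a where a: "a \<in> A" by blast
      then have "a \<in> Y" using A \<U> by blast
      then obtain x where x: "x \<in> X" "dist a (f x) < R"
        using near by blast
      obtain W where W: "W \<in> \<W>" "x \<in> core W"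
        using \<W>(4) x(1) unfolding core_def by blast
      have "dist y (f x) < s" if "y \<in> A" for y
        using D(2) A a that x(2) dist_triangle[of y "f x" a] unfolding s_def by fastforce
      then have "A \<subseteq> T W"
        using W(2) A \<U> unfolding T_def by blast
      with W(1) show ?thesis unfolding \<V>_def by blast
    qed
  qed
  moreover have "\<V> \<subseteq> Pow Y"
    unfolding \<V>_def T_def by blast
  ultimately show "\<exists>\<V>\<subseteq>Pow Y. uniformly_bounded \<V> \<and>
      family_dim \<V> \<le> enat ((m + 1) * n - 1) \<and> coarsens \<V> \<U>"
    by (intro exI[of _ \<V>] conjI)
qed

theorem theorem6p1:
  fixes X :: "'a::metric_space set" and Y :: "'b::metric_space set"
    and f :: "'a \<Rightarrow> 'b" and n :: nat
  assumes "n \<ge> 1"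
    and "bornologous X Y f"
    and "coarsely_n_to_1 n X Y f"
    and "coarsely_surjective X Y f"
  shows "asdim X \<le> asdim Y \<and> asdim Y \<le> (asdim X + 1) * enat n - 1"
proof
  show "asdim X \<le> asdim Y"
  proof (cases "asdim Y")
    case (enat m)
    then show ?thesis
      using asdim_le asdim_at_most_domain[OF assms(2,3)] asdim_at_most_asdim by metis
  qed simp
  show "asdim Y \<le> (asdim X + 1) * enat n - 1"
  proof (cases "asdim X")
    case (enat m)
    then have "asdim Y \<le> enat ((m + 1) * n - 1)"
      using asdim_le asdim_at_most_codomain[OF assms] asdim_at_most_asdim by blast
    with enat show ?thesis
      by (simp add: one_enat_def)
  next
    \<comment> \<open>A positive \<open>n\<close> keeps the product infinite; with \<open>n\<close>
      equal to 0 it would vanish.\<close>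
    case infinity
    then show ?thesis
      using assms(1) by (simp add: imult_is_infinity)
  qed
qed

end
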